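(* Let $f,h$ be continuously differentiable. Suppose there exists a diffeomorphism $\phi:\mathbb{R}^n\to\mathbb{R}^n$ such that $\bar h(\bar x,u,w):=h(\phi^{-1}(\bar x),u,w)$ is affine in $(\bar x,w)$ and $\partial\bar h/\partial\bar x_i=0$ for all $i=1,\ldots,n-p$. Let $P:\mathbb{R}^n\to\mathbb{R}^{n\times n}$ be a Riemannian metric such that $$P(x)=\frac{\partial\phi}{\partial x}(x)^\top\,\bar P(\phi(x))\,\frac{\partial\phi}{\partial x}(x),\qquad \bar P(\bar x)=\begin{pmatrix}\bar P_x(\bar x_x)&0\\0&\bar P_y\end{pmatrix},$$ for some $\bar P_x:\mathbb{R}^{n-p}\to\mathbb{R}^{(n-p)\times(n-p)}$ and a constant matrix $\bar P_y\in\mathbb{R}^{p\times p}$, where $\bar x=(\bar x_x^\top,\bar x_y^\top)^\top$ with $\bar x_x\in\mathbb{R}^{n-p}$, $\bar x_y\in\mathbb{R}^p$. Let $\mathbb{X}$ be weakly geodesically convex (with respect to $P$), and let $\mathbb{W}$ be convex. If there exist $\eta\in[0,1)$ and symmetric matrices $P_1,P_2\succ0$ and $Q,R\succeq0$ such that $$\begin{pmatrix}A^\top P_+A-\eta P-C^\top RC & A^\top P_+B-C^\top RD\\ B^\top P_+A-D^\top RC & B^\top P_+B-Q-D^\top RD\end{pmatrix}\preceq0$$ and $$P_1\preceq P(x)\preceq P_2$$ hold for all $(x,u,w)\in\mathbb{X}\times\mathbb{U}\times\mathbb{W}$, where $P=P(x)$, $P_+=P(x^+)$ with $x^+=f(x,u,w)$,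 and $A=\frac{\partial f}{\partial x}$, $B=\frac{\partial f}{\partial w}$, $C=\frac{\partial h}{\partial x}$, $D=\frac{\partial h}{\partial w}$ are evaluated at $(x,u,w)$, then there exists a quadratically bounded (exponential) $\delta$-IOSS Lyapunov function $W_\delta$ for the system $x_{t+1}=f(x_t,u_t,w_t)$, $y_t=h(x_t,u_t,w_t)$.
   Context: System: $x_{t+1}=f(x_t,u_t,w_t)$, $y_t=h(x_t,u_t,w_t)$, with $f:\mathbb{R}^n\times\mathbb{R}^m\times\mathbb{R}^q\to\mathbb{R}^n$, $h:\mathbb{R}^n\times\mathbb{R}^m\times\mathbb{R}^q\to\mathbb{R}^p$ (state $x$, input $u$, disturbance $w$, output $y$). Sets $\mathbb{X}\subseteq\mathbb{R}^n$, $\mathbb{U}\subseteq\mathbb{R}^m$, $\mathbb{W}\subseteq\mathbb{R}^q$, $\mathbb{Y}\subseteq\mathbb{R}^p$ are given and $\mathbb{Z}:=\mathbb{X}\times\mathbb{U}\times\mathbb{W}\times\mathbb{Y}$. $\|x\|_Q^2=x^\top Qx$ for symmetric positive (semi)definite $Q$. Quadratically bounded (exponential) $\delta$-IOSS Lyapunov function: a function $W_\delta:\mathbb{R}^n\times\mathbb{R}^n\to\mathbb{R}_{\ge0}$ for which there exist a decay rate in $[0,1)$, denoted $\eta$, and symmetric matrices, denoted $P_1,P_2\succ0$ and $Q,R\succeq0$, such that (a) $\|x-\tilde x\|_{P_1}^2\le W_\delta(x,\tilde x)\le\|x-\tilde x\|_{P_2}^2$ and (b) $W_\delta(f(x,u,w),f(\tilde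 x,u,\tilde w))\le\eta W_\delta(x,\tilde x)+\|w-\tilde w\|_Q^2+\|y-\tilde y\|_R^2$ for all $(x,u,w,y),(\tilde x,u,\tilde w,\tilde y)\in\mathbb{Z}$, where $y=h(x,u,w)$ and $\tilde y=h(\tilde x,u,\tilde w)$. Riemannian metric: a (smooth) map $P:\mathbb{R}^n\to\mathbb{R}^{n\times n}$ with symmetric positive definite values. The Riemannian energy of a smooth path $c:[0,1]\to\mathbb{R}^n$ is $E(c)=\int_0^1\frac{dc}{ds}(s)^\top P(c(s))\frac{dc}{ds}(s)\,ds$; a minimizing geodesic between two points is a smooth path joining them that minimizes $E$ among all smooth paths joining them. A set $\mathbb{X}\subseteq\mathbb{R}^n$ is weakly geodesically convex if any two points of $\mathbb{X}$ are joined by a minimizing geodesic that stays in $\mathbb{X}$ for all $s\in[0,1]$ (for constant $P$ this is ordinary convexity).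
   Formalization: Adds the hypothesis that P is bounded on the convex hull of X; without it the claim fails, since P ⪯ P_2 on a merely weakly geodesically convex X does not bound the energy by a multiple of the squared Euclidean distance. It is automatic for X convex or bounded, or P constant or globally bounded. *)

theory Defs
  imports "HOL-Analysis.Analysis"
begin

section \<open>Smoothness\<close>

text \<open>Continuous differentiability on the whole space: the derivative is continuous in the
  operator norm.\<close>

definition C1_map :: "('a::real_normed_vector \<Rightarrow> 'b::real_normed_vector) \<Rightarrow> bool" where
  "C1_map g \<longleftrightarrow>
    (\<exists>g' :: 'a \<Rightarrow> 'a \<Rightarrow>\<^sub>L 'b.
       (\<forall>x. (g has_derivative blinfun_apply (g' x)) (at x)) \<and> continuous_on UNIV g')"

definition C1_diffeomorphism :: "('a::real_normed_vector \<Rightarrow> 'b::real_normed_vector) \<Rightarrow> bool" where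
  "C1_diffeomorphism \<phi> \<longleftrightarrow> bij \<phi> \<and> C1_map \<phi> \<and> C1_map (inv \<phi>)"

text \<open>Infinite differentiability: all iterated directional derivatives exist and are
  differentiable. To be used on open sets or on nondegenerate real intervals, where
  derivatives relative to the set are unique; values outside \<open>S\<close> are irrelevant.\<close>

coinductive smooth_on :: "'a::real_normed_vector set \<Rightarrow> ('a \<Rightarrow> 'b::real_normed_vector) \<Rightarrow> bool"
  for S where
  "g differentiable_on S \<Longrightarrow>
   (\<forall>v. smooth_on S (\<lambda>x. frechet_derivative g (at x within S) v)) \<Longrightarrow>
   smooth_on S g"

definition affine_map :: "('a::real_vector \<Rightarrow> 'b::real_vector) \<Rightarrow> bool" where
  "affine_map g \<longleftrightarrow> (\<exists>L b. linear L \<and> (\<forall>x. g x = L x + b))"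


section \<open>Matrices\<close>

definition pos_semidef :: "real^'n^'n \<Rightarrow> bool" where
  "pos_semidef M \<longleftrightarrow> transpose M = M \<and> (\<forall>v. 0 \<le> v \<bullet> (M *v v))"

definition pos_def :: "real^'n^'n \<Rightarrow> bool" where
  "pos_def M \<longleftrightarrow> transpose M = M \<and> (\<forall>v. v \<noteq> 0 \<longrightarrow> 0 < v \<bullet> (M *v v))"

definition loewner_le :: "real^'n^'n \<Rightarrow> real^'n^'n \<Rightarrow> bool" (infix "\<preceq>" 50) where
  "M \<preceq> N \<longleftrightarrow> pos_semidef (N - M)"

definition wnorm2 :: "real^'n^'n \<Rightarrow> real^'n \<Rightarrow> real" where
  "wnorm2 Q x = x \<bullet> (Q *v x)"

definition block_matrix ::
  "'a^'c^'r \<Rightarrow> 'a^'d^'r \<Rightarrow> 'a^'c^'s \<Rightarrow> 'a^'d^'s \<Rightarrow> 'a^('c + 'd)^('r + 's)" where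
  "block_matrix A B C D =
    (\<chi> i j. case i of
        Inl k \<Rightarrow> (case j of Inl l \<Rightarrow> A $ k $ l | Inr l \<Rightarrow> B $ k $ l)
      | Inr k \<Rightarrow> (case j of Inl l \<Rightarrow> C $ k $ l | Inr l \<Rightarrow> D $ k $ l))"


section \<open>Riemannian metrics on Euclidean space\<close>

definition riemannian_metric :: "(real^'n \<Rightarrow> real^'n^'n) \<Rightarrow> bool" where
  "riemannian_metric P \<longleftrightarrow> smooth_on UNIV P \<and> (\<forall>x. pos_def (P x))"

definition energy :: "(real^'n \<Rightarrow> real^'n^'n) \<Rightarrow> (real \<Rightarrow> real^'n) \<Rightarrow> real" where
  "energy P c =
    integral {0..1} (\<lambda>s. wnorm2 (P (c s)) (vector_derivative c (at s within {0..1})))"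

definition smooth_path_between :: "real^'n \<Rightarrow> real^'n \<Rightarrow> (real \<Rightarrow> real^'n) \<Rightarrow> bool" where
  "smooth_path_between x y c \<longleftrightarrow> smooth_on {0..1} c \<and> c 0 = x \<and> c 1 = y"

definition minimizing_geodesic ::
  "(real^'n \<Rightarrow> real^'n^'n) \<Rightarrow> real^'n \<Rightarrow> real^'n \<Rightarrow> (real \<Rightarrow> real^'n) \<Rightarrow> bool" where
  "minimizing_geodesic P x y c \<longleftrightarrow>
    smooth_path_between x y c \<and> (\<forall>d. smooth_path_between x y d \<longrightarrow> energy P c \<le> energy P d)"

text \<open>Such a set need not be convex in the Euclidean sense, so a bound on the metric over the
  set gives no bound on the metric along the segments joining its points.\<close>

definition weakly_geodesically_convex :: "(real^'n \<Rightarrow> real^'n^'n) \<Rightarrow> (real^'n) set \<Rightarrow> bool" where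
  "weakly_geodesically_convex P X \<longleftrightarrow>
    (\<forall>x\<in>X. \<forall>y\<in>X. \<exists>c. minimizing_geodesic P x y c \<and> (\<forall>s\<in>{0..1}. c s \<in> X))"

text \<open>An injection \<open>e\<close> of the output indices into the state indices singles out the coordinates
  \<open>x\<^sub>y\<close> (those in \<open>range e\<close>, in the order given by \<open>e\<close>) from the remaining coordinates \<open>x\<^sub>x\<close>.
  The latter are represented as an extensional function on \<open>- range e\<close>, which may be empty.\<close>

definition rest_coords :: "('p \<Rightarrow> 'n) \<Rightarrow> real^'n \<Rightarrow> 'n \<Rightarrow> real" where
  "rest_coords e x = restrict (($) x) (- range e)"

text \<open>The matrix \<open>diag(P\<^sub>x(x\<^sub>x), P\<^sub>y)\<close> with respect to this splitting; only the entries of \<open>P\<^sub>x\<close>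
  at index pairs in \<open>- range e\<close> are used.\<close>

definition split_metric ::
  "('p \<Rightarrow> 'n) \<Rightarrow> (('n \<Rightarrow> real) \<Rightarrow> 'n \<Rightarrow> 'n \<Rightarrow> real) \<Rightarrow> real^'p^'p \<Rightarrow> real^'n \<Rightarrow> real^'n^'n" where
  "split_metric e Px Py x =
    (\<chi> i j. if i \<notin> range e \<and> j \<notin> range e then Px (rest_coords e x) i j
           else if i \<in> range e \<and> j \<in> range e then Py $ inv e i $ inv e j
           else 0)"


section \<open>Incremental input/output-to-state stability\<close>

definition quad_bounded_dIOSS_Lyapunov ::
  "((real^'n) \<times> (real^'m) \<times> (real^'q) \<Rightarrow> real^'n) \<Rightarrow> ((real^'n) \<times> (real^'m) \<times> (real^'q) \<Rightarrow> real^'p) \<Rightarrow>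
   (real^'n) set \<Rightarrow> (real^'m) set \<Rightarrow> (real^'q) set \<Rightarrow> (real^'p) set \<Rightarrow>
   (real^'n \<Rightarrow> real^'n \<Rightarrow> real) \<Rightarrow> bool" where
  "quad_bounded_dIOSS_Lyapunov f h X U W Y V \<longleftrightarrow>
    (\<forall>x x'. 0 \<le> V x x') \<and>
    (\<exists>\<eta> P1 P2 Q R. 0 \<le> \<eta> \<and> \<eta> < 1 \<and>
       pos_def P1 \<and> pos_def P2 \<and> pos_semidef Q \<and> pos_semidef R \<and>
       (\<forall>x u w y x' w' y'.
          (x, u, w, y) \<in> X \<times> U \<times> W \<times> Y \<and> y = h (x, u, w) \<and>
          (x', u, w', y') \<in> X \<times> U \<times> W \<times> Y \<and> y' = h (x', u, w') \<longrightarrow>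
            wnorm2 P1 (x - x') \<le> V x x' \<and>
            V x x' \<le> wnorm2 P2 (x - x') \<and>
            V (f (x, u, w)) (f (x', u, w'))
              \<le> \<eta> * V x x' + wnorm2 Q (w - w') + wnorm2 R (y - y')))"

end

(* The Lyapunov function is the infimum of the Riemannian energy over smooth paths joining the two
   states. Pushing a minimizing geodesic forward through f and integrating the matrix inequality
   along it gives the decrease estimate, except that the output term appears as the integral of
   |dy/ds|_R^2, which Jensen's inequality bounds in the wrong direction. In the coordinates phi,
   however, the metric splits off a constant block, so the output coordinates of the geodesic are
   traversed at constant speed; as h is affine in these coordinates, dy/ds is constant and the
   integral equals |y - y'|_R^2. As f and phi are only continuously differentiable, the paths
   obtained from geodesics are not smooth; by the Weierstrass theorem the infimum over smooth paths
   is nevertheless a lower bound for their energies. *)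

theory Submission
  imports Defs
begin

section \<open>Quadratic forms\<close>

lemma wnorm2_nonneg: "pos_semidef M \<Longrightarrow> 0 \<le> wnorm2 M v"
  by (simp add: pos_semidef_def wnorm2_def)

lemma pos_def_imp_pos_semidef: "pos_def M \<Longrightarrow> pos_semidef M"
  unfolding pos_def_def pos_semidef_def
  by (metis inner_zero_left less_eq_real_def)

lemma wnorm2_eq_0_imp: "pos_def M \<Longrightarrow> wnorm2 M v = 0 \<Longrightarrow> v = 0"
  unfolding pos_def_def wnorm2_def by force

lemma wnorm2_minus: "wnorm2 M (- v) = wnorm2 M v"
  by (simp add: wnorm2_def linear_neg[OF matrix_vector_mul_linear])

lemma wnorm2_minus_commute: "wnorm2 M (v - w) = wnorm2 M (w - v)"
  using wnorm2_minus[of M "v - w"] by simp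

text \<open>The two outer matrices may differ, so that the off-diagonal blocks of the matrix
  inequality are covered as well as plain congruences.\<close>

lemma inner_transpose_mult: "v \<bullet> ((transpose A ** M ** B) *v w) = (A *v v) \<bullet> (M *v (B *v w))"
  for M :: "real^'m^'n" and A :: "real^'a^'n" and B :: "real^'b^'m"
  by (metis dot_lmul_matrix inner_commute matrix_vector_mul_assoc transpose_matrix_vector)

lemma wnorm2_congruence: "wnorm2 (transpose J ** M ** J) v = wnorm2 M (J *v v)"
  by (simp add: wnorm2_def inner_transpose_mult)

lemma wnorm2_diff_symmetric:
  assumes "transpose M = M"
  shows "wnorm2 M (v - w) = wnorm2 M v - 2 * (w \<bullet> (M *v v)) + wnorm2 M w"
proof -
  have "v \<bullet> (M *v w) = w \<bullet> (M *v v)"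
    by (metis assms dot_lmul_matrix inner_commute transpose_matrix_vector)
  then show ?thesis
    by (simp add: wnorm2_def matrix_vector_mult_diff_distrib inner_diff_left inner_diff_right)
qed

lemma loewner_le_imp_wnorm2_le: "M \<preceq> N \<Longrightarrow> wnorm2 M v \<le> wnorm2 N v"
  by (auto simp: loewner_le_def pos_semidef_def wnorm2_def matrix_vector_mult_diff_rdistrib
      inner_diff_right)

lemma continuous_on_wnorm2 [continuous_intros]:
  assumes "continuous_on S M" "continuous_on S v"
  shows "continuous_on S (\<lambda>s. wnorm2 (M s) (v s))"
  unfolding wnorm2_def matrix_vector_mult_def inner_vec_def
  by (auto intro!: continuous_intros assms)

text \<open>Matrix-vector multiplication is bounded and bilinear, so the Cauchy-Schwarz inequality
  turns a bound on the matrices into a common bound on their quadratic forms. This supplies the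
  constant in the upper bound on the Lyapunov function.\<close>

lemma bounded_wnorm2_le:
  fixes S :: "(real^'n^'n) set"
  assumes "bounded S"
  obtains K where "0 < K" "\<forall>M\<in>S. \<forall>v. wnorm2 M v \<le> K * (norm v)\<^sup>2"
proof -
  have "bilinear ((*v) :: real^'n^'n \<Rightarrow> real^'n \<Rightarrow> real^'n)"
    unfolding bilinear_def
    by (auto intro!: linearI simp: matrix_vector_mult_add_rdistrib matrix_vector_right_distrib
        scaleR_matrix_vector_assoc matrix_vector_mult_scaleR)
  then obtain B where B: "0 < B" "\<And>(M :: real^'n^'n) v. norm (M *v v) \<le> B * norm M * norm v"
    using bilinear_bounded_pos by blast
  obtain b where b: "0 < b" "\<And>M. M \<in> S \<Longrightarrow> norm M \<le> b"
    using assms bounded_pos by blast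
  have "wnorm2 M v \<le> (B * b) * (norm v)\<^sup>2" if "M \<in> S" for M v
  proof -
    have "wnorm2 M v \<le> norm v * norm (M *v v)"
      unfolding wnorm2_def by (rule norm_cauchy_schwarz)
    also have "\<dots> \<le> norm v * (B * b * norm v)"
      using B(2)[of M v] b(2)[OF that] B(1)
      by (meson mult_left_mono mult_right_mono norm_ge_zero order_trans less_imp_le)
    finally show ?thesis by (simp add: power2_eq_square ac_simps)
  qed
  with B(1) b(1) show thesis by (intro that[of "B * b"]) auto
qed

lemma wnorm2_scaled_identity: "wnorm2 (K *\<^sub>R mat 1) v = K * (norm v)\<^sup>2"
  by (simp add: wnorm2_def power2_norm_eq_inner flip: scaleR_matrix_vector_assoc)

lemma pos_def_scaled_identity:
  assumes "0 < K"
  shows "pos_def (K *\<^sub>R (mat 1 :: real^'n^'n))"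
proof -
  have "transpose (K *\<^sub>R (mat 1 :: real^'n^'n)) = K *\<^sub>R mat 1"
    by (auto simp: transpose_def mat_def vec_eq_iff)
  then show ?thesis
    using assms unfolding pos_def_def wnorm2_scaled_identity[unfolded wnorm2_def] by simp
qed

section \<open>Continuously differentiable paths\<close>

text \<open>The derivative is an explicit argument, so that integrals along the path can name it. It
  is one-sided at the end points, in agreement with the derivative in \<open>energy\<close>.\<close>

definition C1_path :: "(real \<Rightarrow> 'a::real_normed_vector) \<Rightarrow> (real \<Rightarrow> 'a) \<Rightarrow> bool" where
  "C1_path c c' \<longleftrightarrow>
    (\<forall>s\<in>{0..1}. (c has_vector_derivative c' s) (at s within {0..1})) \<and> continuous_on {0..1} c'"

lemma C1_path_continuous: "C1_path c c' \<Longrightarrow> continuous_on {0..1} c"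
  unfolding C1_path_def
  by (meson continuous_on_eq_continuous_within has_vector_derivative_continuous)

lemma C1_path_linear:
  assumes "C1_path c c'" "bounded_linear L"
  shows "C1_path (\<lambda>s. L (c s)) (\<lambda>s. L (c' s))"
  using assms unfolding C1_path_def
  by (auto intro: bounded_linear.has_vector_derivative bounded_linear.continuous_on)

lemma C1_path_add:
  "C1_path c c' \<Longrightarrow> C1_path d d' \<Longrightarrow> C1_path (\<lambda>s. c s + d s) (\<lambda>s. c' s + d' s)"
  unfolding C1_path_def by (auto intro!: derivative_intros continuous_intros)

lemma C1_path_Pair:
  "C1_path c c' \<Longrightarrow> C1_path d d' \<Longrightarrow> C1_path (\<lambda>s. (c s, d s)) (\<lambda>s. (c' s, d' s))"
  unfolding C1_path_def by (auto intro!: derivative_intros continuous_intros)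

lemma C1_path_line: "C1_path (\<lambda>s. x + s *\<^sub>R v) (\<lambda>_. v)"
  unfolding C1_path_def by (auto intro!: derivative_eq_intros)

lemma C1_path_compose:
  fixes c :: "real \<Rightarrow> 'a::real_normed_vector" and g :: "'a \<Rightarrow> 'b::real_normed_vector"
  assumes "C1_path c c'"
    and g: "\<And>x. (g has_derivative blinfun_apply (g' x)) (at x)" "continuous_on UNIV g'"
  shows "C1_path (\<lambda>s. g (c s)) (\<lambda>s. blinfun_apply (g' (c s)) (c' s))"
  unfolding C1_path_def
proof (intro conjI ballI)
  fix s :: real assume s: "s \<in> {0..1}"
  have "(c has_vector_derivative c' s) (at s within {0..1})"
    using assms(1) s by (simp add: C1_path_def)
  from vector_derivative_diff_chain_within[OF this has_derivative_at_withinI[OF g(1)]]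
  show "((\<lambda>s. g (c s)) has_vector_derivative blinfun_apply (g' (c s)) (c' s)) (at s within {0..1})"
    by (simp add: o_def)
next
  have "continuous_on {0..1} (\<lambda>s. g' (c s))"
    using continuous_on_compose2[OF g(2) C1_path_continuous[OF assms(1)]] by simp
  then show "continuous_on {0..1} (\<lambda>s. blinfun_apply (g' (c s)) (c' s))"
    using assms(1) by (auto simp: C1_path_def intro!: continuous_intros)
qed

lemma C1_path_has_integral:
  fixes c :: "real \<Rightarrow> 'a::banach"
  assumes "C1_path c c'" "s \<in> {0..1}"
  shows "(c' has_integral c s - c 0) {0..s}"
proof (rule fundamental_theorem_of_calculus)
  show "(c has_vector_derivative c' t) (at t within {0..s})" if "t \<in> {0..s}" for t
    using assms that unfolding C1_path_def
    by (meson atLeastAtMost_iff atLeastatMost_subset_iff has_vector_derivative_within_subset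
        order_refl order_trans)
qed (use assms in auto)

lemma C1_path_unique:
  assumes "C1_path c c'" "C1_path c d'" "s \<in> {0..1}"
  shows "c' s = d' s"
  using assms vector_derivative_within_cbox[of 0 1 s c] unfolding C1_path_def
  by (metis box_real(2) zero_less_one)

lemma energy_C1_path:
  assumes "C1_path c c'"
  shows "energy P c = integral {0..1} (\<lambda>s. wnorm2 (P (c s)) (c' s))"
  unfolding energy_def
proof (rule integral_cong)
  fix s :: real assume s: "s \<in> {0..1}"
  have "vector_derivative c (at s within {0..1}) = c' s"
    using assms s vector_derivative_within_cbox[of 0 1 s c "c' s"] by (simp add: C1_path_def)
  then show "wnorm2 (P (c s)) (vector_derivative c (at s within {0..1})) = wnorm2 (P (c s)) (c' s)"
    by simp
qed

lemma continuous_on_energy_density: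
  assumes "C1_path c c'" "continuous_on UNIV P"
  shows "continuous_on {0..1} (\<lambda>s. wnorm2 (P (c s)) (c' s))"
  using assms continuous_on_compose2[OF assms(2) C1_path_continuous[OF assms(1)]]
  by (auto simp: C1_path_def intro!: continuous_intros)

text \<open>The variance identity behind both Jensen's inequality and its equality case.\<close>

lemma integral_wnorm2_deviation:
  fixes c :: "real \<Rightarrow> real^'n"
  assumes "C1_path c c'" "transpose M = M"
  shows "integral {0..1} (\<lambda>s. wnorm2 M (c' s - (c 1 - c 0)))
    = integral {0..1} (\<lambda>s. wnorm2 M (c' s)) - wnorm2 M (c 1 - c 0)"
proof -
  define v where "v = c 1 - c 0"
  have "((\<lambda>s. v \<bullet> (M *v c' s)) has_integral v \<bullet> (M *v v)) {0..1}"
    using has_integral_linear[OF C1_path_has_integral[OF assms(1), of 1],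
        of "\<lambda>x. v \<bullet> (M *v x)"]
    by (simp add: v_def o_def bounded_linear_inner_right_comp matrix_vector_mul_bounded_linear)
  moreover have "((\<lambda>s. wnorm2 M (c' s)) has_integral integral {0..1} (\<lambda>s. wnorm2 M (c' s))) {0..1}"
    using assms(1) unfolding C1_path_def
    by (intro integrable_integral integrable_continuous_real) (auto intro!: continuous_intros)
  moreover have "((\<lambda>_. wnorm2 M v) has_integral wnorm2 M v) {0..1::real}"
    using has_integral_const_real[of "wnorm2 M v" 0 1] by simp
  ultimately have "((\<lambda>s. wnorm2 M (c' s) - 2 * (v \<bullet> (M *v c' s)) + wnorm2 M v) has_integral
      integral {0..1} (\<lambda>s. wnorm2 M (c' s)) - 2 * (v \<bullet> (M *v v)) + wnorm2 M v) {0..1}"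
    by (intro has_integral_add has_integral_diff has_integral_mult_right)
  then have "((\<lambda>s. wnorm2 M (c' s - v)) has_integral
      integral {0..1} (\<lambda>s. wnorm2 M (c' s)) - wnorm2 M v) {0..1}"
    by (simp add: wnorm2_diff_symmetric[OF assms(2)]) (simp add: wnorm2_def)
  then show ?thesis by (simp add: v_def integral_unique)
qed

text \<open>Jensen's inequality: the squared deviation of the velocity from its mean has a
  nonnegative integral.\<close>

lemma wnorm2_displacement_le_integral:
  fixes c :: "real \<Rightarrow> real^'n"
  assumes "C1_path c c'" "pos_semidef M"
  shows "wnorm2 M (c 1 - c 0) \<le> integral {0..1} (\<lambda>s. wnorm2 M (c' s))"
proof -
  have "0 \<le> integral {0..1} (\<lambda>s. wnorm2 M (c' s - (c 1 - c 0)))"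
    using assms unfolding C1_path_def
    by (intro integral_nonneg integrable_continuous_real)
       (auto intro!: continuous_intros wnorm2_nonneg)
  then show ?thesis
    using integral_wnorm2_deviation[OF assms(1)] assms(2) by (simp add: pos_semidef_def)
qed

text \<open>The equality case of Jensen's inequality: the integral of the squared deviation
  vanishes, hence so does its continuous nonnegative integrand, and definiteness of \<open>M\<close>
  makes the deviation itself zero.\<close>

lemma straight_if_integral_wnorm2_le:
  fixes c :: "real \<Rightarrow> real^'n"
  assumes c: "C1_path c c'" and "pos_def M"
    and "integral {0..1} (\<lambda>s. wnorm2 M (c' s)) \<le> wnorm2 M (c 1 - c 0)" and "s \<in> {0..1}"
  shows "c' s = c 1 - c 0"
proof -
  let ?g = "\<lambda>s. wnorm2 M (c' s - (c 1 - c 0))"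
  have cont: "continuous_on {0..1} ?g"
    using c unfolding C1_path_def by (auto intro!: continuous_intros)
  have nonneg: "0 \<le> ?g s" for s
    by (simp add: assms(2) pos_def_imp_pos_semidef wnorm2_nonneg)
  have "integral {0..1} ?g \<le> 0"
    using integral_wnorm2_deviation[OF c] assms(2,3) by (simp add: pos_def_def)
  moreover have "0 \<le> integral {0..1} ?g"
    using cont nonneg by (intro integral_nonneg integrable_continuous_real) auto
  ultimately have "?g s = 0"
    using integral_eq_0_iff[OF cont _ nonneg] assms(4) by simp
  from wnorm2_eq_0_imp[OF assms(2) this] show ?thesis by simp
qed

section \<open>Smooth paths\<close>

lemma has_vector_derivative_frechet_derivative:
  "(g has_vector_derivative g') (at x within {0..1}) \<Longrightarrow> x \<in> {0..1} \<Longrightarrow>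
    frechet_derivative g (at x within {0..1}) v = v *\<^sub>R g'" for g' :: "'a::real_normed_vector"
  using frechet_derivative_within_cbox[of 0 1 x g "\<lambda>v. v *\<^sub>R g'"]
  by (simp add: has_vector_derivative_def)

text \<open>Coinduction with the invariant of agreeing with some polynomial on
  \<open>{0..1}\<close>, which differentiation preserves. Agreement is asked only on the interval
  because \<open>frechet_derivative\<close> has no determined value at points outside it.\<close>

lemma smooth_on_polynomial_function:
  fixes p :: "real \<Rightarrow> 'a::euclidean_space"
  assumes "polynomial_function p" "\<And>x. x \<in> {0..1} \<Longrightarrow> g x = p x"
  shows "smooth_on {0..1} g"
proof -
  define X where "X g \<longleftrightarrow> (\<exists>p. polynomial_function p \<and> (\<forall>x\<in>{0..1}. g x = p x))"
    for g :: "real \<Rightarrow> 'a"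
  have "X g" using assms by (auto simp: X_def)
  then show ?thesis
  proof (coinduction arbitrary: g rule: smooth_on.coinduct)
    case (smooth_on g)
    then obtain p where p: "polynomial_function p" "\<And>x. x \<in> {0..1} \<Longrightarrow> g x = p x"
      by (auto simp: X_def)
    obtain p' where p': "polynomial_function p'" "\<And>x. (p has_vector_derivative (p' x)) (at x)"
      using has_vector_derivative_polynomial_function[OF p(1)] by blast
    have g': "(g has_vector_derivative (p' x)) (at x within {0..1})" if "x \<in> {0..1}" for x
      by (rule has_vector_derivative_transform[OF that p(2)
            has_vector_derivative_at_within[OF p'(2)]])
    then have "g differentiable_on {0..1}"
      unfolding differentiable_on_def by (blast intro: differentiableI_vector)
    moreover have "X (\<lambda>x. frechet_derivative g (at x within {0..1}) v)" for v
      unfolding X_def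
    proof (intro exI conjI ballI)
      show "polynomial_function (\<lambda>x. v *\<^sub>R p' x)" using p'(1) by auto
    qed (use g' has_vector_derivative_frechet_derivative in blast)
    ultimately show ?case by blast
  qed
qed

text \<open>A single unfolding of \<open>smooth_on\<close> reduces the claim to the polynomial
  derivative. Approximating paths can thus be defined as integrals, without exhibiting the
  antiderivative as a polynomial.\<close>

lemma smooth_on_polynomial_derivative:
  fixes p :: "real \<Rightarrow> 'a::euclidean_space"
  assumes "polynomial_function p" "C1_path d p"
  shows "smooth_on {0..1} d"
proof (rule smooth_on.intros)
  show "d differentiable_on {0..1}"
    using assms(2)
    unfolding C1_path_def differentiable_on_def by (blast intro: differentiableI_vector)
  show "\<forall>v. smooth_on {0..1} (\<lambda>x. frechet_derivative d (at x within {0..1}) v)"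
  proof
    fix v
    show "smooth_on {0..1} (\<lambda>x. frechet_derivative d (at x within {0..1}) v)"
    proof (rule smooth_on_polynomial_function)
      show "polynomial_function (\<lambda>x. v *\<^sub>R p x)" using assms(1) by auto
      show "frechet_derivative d (at x within {0..1}) v = v *\<^sub>R p x" if "x \<in> {0..1}" for x
        using assms(2) that unfolding C1_path_def
        by (intro has_vector_derivative_frechet_derivative) blast+
    qed
  qed
qed

lemma smooth_on_imp_differentiable_on: "smooth_on S g \<Longrightarrow> g differentiable_on S"
  by (erule smooth_on.cases) simp

text \<open>Unfolding smoothness twice shows that the derivative in direction 1 is itself
  differentiable, hence continuous.\<close>

lemma smooth_on_C1_path:
  fixes c :: "real \<Rightarrow> 'a::real_normed_vector"
  assumes "smooth_on {0..1} c"
  obtains c' where "C1_path c c'"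
proof
  let ?c' = "\<lambda>s. frechet_derivative c (at s within {0..1}) 1"
  have d: "c differentiable_on {0..1}" "smooth_on {0..1} ?c'"
    using assms by (auto elim: smooth_on.cases)
  have "(c has_vector_derivative ?c' s) (at s within {0..1})" if "s \<in> {0..1}" for s
  proof -
    have D: "(c has_derivative frechet_derivative c (at s within {0..1})) (at s within {0..1})"
      using d(1) that by (simp add: differentiable_on_def frechet_derivative_works)
    have "frechet_derivative c (at s within {0..1}) v = v *\<^sub>R ?c' s" for v
      using linear_scale[OF has_derivative_linear[OF D], of v 1] by simp
    then have "frechet_derivative c (at s within {0..1}) = (\<lambda>v. v *\<^sub>R ?c' s)" by blast
    with D show ?thesis unfolding has_vector_derivative_def by metis
  qed
  moreover have "continuous_on {0..1} ?c'"
    using d(2) differentiable_imp_continuous_on smooth_on_imp_differentiable_on by blast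
  ultimately show "C1_path c ?c'" by (simp add: C1_path_def)
qed

text \<open>The Weierstrass theorem is applied to the derivative rather than to the path:
  integrating a uniform approximation of \<open>c'\<close> controls the path and its derivative
  together.\<close>

lemma C1_path_approximation:
  fixes c :: "real \<Rightarrow> 'a::euclidean_space"
  assumes c: "C1_path c c'"
  obtains d d' where "\<And>n. smooth_on {0..1} (d n)" "\<And>n. C1_path (d n) (d' n)"
    "\<And>n. d n 0 = c 0" "\<And>n. d n 1 = c 1"
    "uniform_limit {0..1} d c sequentially" "uniform_limit {0..1} d' c' sequentially"
proof -
  have cont: "continuous_on {0..1} c'" using c by (simp add: C1_path_def)
  obtain g where g: "uniform_limit {0..1} g c' sequentially" "\<And>n::nat. polynomial_function (g n)"
    using Stone_Weierstrass_uniform_limit[OF compact_Icc cont] by blast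
  have gc: "continuous_on S (g n)" for n S
    by (rule continuous_on_polymonial_function[OF g(2)])
  define v where "v = c 1 - c 0"
  define m where "m n = integral {0..1} (g n)" for n
  \<comment> \<open>The constant \<open>v - m n\<close> gives \<open>d' n\<close> exactly the mean
    velocity \<open>v\<close>, so that \<open>d n\<close> ends at \<open>c 1\<close>. It tends to
    zero because the integrals \<open>m n\<close> converge to the integral of \<open>c'\<close>,
    which is \<open>v\<close>.\<close>
  define d' where "d' n s = g n s + (v - m n)" for n s
  define d where "d n s = c 0 + integral {0..s} (d' n)" for n s
  obtain I J where IJ: "\<And>n. (g n has_integral I n) {0..1}" "(c' has_integral J) {0..1}"
      "I \<longlonglongrightarrow> J"
    using uniform_limit_integral[OF g(1) gc] by auto
  have "I = m" using integral_unique[OF IJ(1)] by (auto simp: m_def)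
  moreover have "J = v"
    using C1_path_has_integral[OF c, of 1] IJ(2) by (simp add: v_def has_integral_unique)
  ultimately have m: "m \<longlonglongrightarrow> v" using IJ(3) by simp
  have "uniform_limit {0..1::real} (\<lambda>n s. v - m n) (\<lambda>_. 0) sequentially"
  proof (rule uniform_limitI)
    fix r :: real assume "0 < r"
    from tendstoD[OF m this]
    show "\<forall>\<^sub>F n in sequentially. \<forall>s\<in>{0..1::real}. dist (v - m n) 0 < r"
      by eventually_elim (simp add: dist_norm norm_minus_commute)
  qed
  from uniform_limit_add[OF g(1) this]
  have lim': "uniform_limit {0..1} d' c' sequentially" by (simp add: d'_def[abs_def])
  have d'_cont: "continuous_on S (d' n)" for S n
    unfolding d'_def by (intro continuous_intros gc)
  have d: "C1_path (d n) (d' n)" for n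
    unfolding C1_path_def
  proof (intro conjI ballI d'_cont)
    show "(d n has_vector_derivative d' n s) (at s within {0..1})" if "s \<in> {0..1}" for s
      unfolding d_def
      using has_vector_derivative_add[OF has_vector_derivative_const
          integral_has_vector_derivative[OF d'_cont that]] by simp
  qed
  have d0: "d n 0 = c 0" for n by (simp add: d_def)
  have d1: "d n 1 = c 1" for n
  proof -
    have "((\<lambda>s. g n s + (v - m n)) has_integral m n + (v - m n)) {0..1}"
      using has_integral_add[OF IJ(1)[of n] has_integral_const_real[of "v - m n" 0 1]]
      by (simp add: \<open>I = m\<close>)
    then show ?thesis by (simp add: d_def d'_def[abs_def] integral_unique v_def)
  qed
  have "uniform_limit {0..1} d c sequentially"
  proof (rule uniform_limitI)
    fix r :: real assume r: "0 < r"
    \<comment> \<open>The integral estimate below is not strict, so half of \<open>r\<close> is kept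
      in reserve.\<close>
    then have "\<forall>\<^sub>F n in sequentially. \<forall>s\<in>{0..1}. dist (d' n s) (c' s) < r / 2"
      by (intro uniform_limitD[OF lim']) simp
    then show "\<forall>\<^sub>F n in sequentially. \<forall>s\<in>{0..1}. dist (d n s) (c s) < r"
    proof eventually_elim
      case (elim n)
      show ?case
      proof
        fix s :: real assume s: "s \<in> {0..1}"
        have "((\<lambda>t. d' n t - c' t) has_integral d n s - d n 0 - (c s - c 0)) {0..s}"
          by (intro has_integral_diff C1_path_has_integral d c s)
        then have "norm (d n s - d n 0 - (c s - c 0)) \<le> r / 2 * measure lborel {0..s}"
          by (rule has_integral_bound_real[rotated 2, where S = "{}"])
             (use r s elim in \<open>auto simp: dist_norm less_imp_le\<close>)
        also have "\<dots> \<le> r / 2" using s r by (simp add: mult_left_le)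
        also have "\<dots> < r" using r by simp
        finally show "dist (d n s) (c s) < r" by (simp add: d0 dist_norm)
      qed
    qed
  qed
  moreover have "smooth_on {0..1} (d n)" for n
  proof (rule smooth_on_polynomial_derivative[OF _ d])
    show "polynomial_function (d' n)" unfolding d'_def using g(2) by auto
  qed
  ultimately show thesis using that d d0 d1 lim' by blast
qed

section \<open>The Riemannian energy between two points\<close>

text \<open>This is the squared Riemannian distance. It is an infimum because no minimizing geodesic
  is assumed between successor states, which may lie outside \<open>X\<close>.\<close>

definition min_energy :: "(real^'n \<Rightarrow> real^'n^'n) \<Rightarrow> real^'n \<Rightarrow> real^'n \<Rightarrow> real" where
  "min_energy P x y = Inf {energy P c |c. smooth_path_between x y c}"

lemma energy_nonneg:
  assumes "\<And>x. pos_semidef (P x)"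
  shows "0 \<le> energy P c"
proof (cases "(\<lambda>s. wnorm2 (P (c s)) (vector_derivative c (at s within {0..1}))) integrable_on {0..1}")
  case True
  then show ?thesis
    unfolding energy_def by (intro integral_nonneg) (auto intro: wnorm2_nonneg assms)
next
  \<comment> \<open>An integral that does not exist has the default value 0, which satisfies the
    bound.\<close>
  case False
  then show ?thesis by (simp add: energy_def not_integrable_integral)
qed

lemma min_energy_le:
  assumes "\<And>x. pos_semidef (P x)" "smooth_path_between x y c"
  shows "min_energy P x y \<le> energy P c"
  unfolding min_energy_def
  by (rule cInf_lower) (use assms energy_nonneg in \<open>auto intro!: bdd_belowI[where m = 0]\<close>)

lemma smooth_path_between_line: "smooth_path_between x y (\<lambda>s. x + s *\<^sub>R (y - x))"
  unfolding smooth_path_between_def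
  using smooth_on_polynomial_derivative[OF _ C1_path_line] by auto

text \<open>The straight line makes the set of energies nonempty, so its infimum is a genuine
  greatest lower bound.\<close>

lemma le_min_energy:
  assumes "\<And>c. smooth_path_between x y c \<Longrightarrow> b \<le> energy P c"
  shows "b \<le> min_energy P x y"
  unfolding min_energy_def
  by (rule cInf_greatest) (use assms smooth_path_between_line in blast)+

text \<open>Smooth paths with the same end points approximate \<open>c\<close> uniformly together
  with its derivative, and their energies converge. This admits as competitors the images of
  geodesics under maps that are only continuously differentiable.\<close>

lemma min_energy_le_C1_path:
  fixes P :: "real^'n \<Rightarrow> real^'n^'n"
  assumes P: "continuous_on UNIV P" "\<And>x. pos_semidef (P x)" and c: "C1_path c c'"
  shows "min_energy P (c 0) (c 1) \<le> integral {0..1} (\<lambda>s. wnorm2 (P (c s)) (c' s))"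
proof -
  obtain d d' where d: "\<And>n. smooth_on {0..1} (d n)" "\<And>n. C1_path (d n) (d' n)"
    "\<And>n. d n 0 = c 0" "\<And>n. d n 1 = c 1"
    and lim: "uniform_limit {0..1} d c sequentially" "uniform_limit {0..1} d' c' sequentially"
    using C1_path_approximation[OF c] by blast
  define F where "F = (\<lambda>(x, v). wnorm2 (P x) v)"
  \<comment> \<open>A compact unit neighbourhood of the curve of positions and velocities: the
    density \<open>F\<close> is uniformly continuous on it, and the approximations eventually stay
    inside.\<close>
  define K where "K = {x + y |x y. x \<in> (\<lambda>s. (c s, c' s)) ` {0..1} \<and> y \<in> cball 0 1}"
  have "compact ((\<lambda>s. (c s, c' s)) ` {0..1})"
    using c C1_path_continuous[OF c]
    by (intro compact_continuous_image continuous_on_Pair) (auto simp: C1_path_def)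
  then have K: "compact K" unfolding K_def by (rule compact_sums) simp
  have "continuous_on K F"
    unfolding F_def case_prod_beta
    by (intro continuous_intros continuous_on_compose2[OF P(1)]) auto
  with K have uc: "uniformly_continuous_on K F" by (rule compact_uniformly_continuous[rotated])
  have limp: "uniform_limit {0..1} (\<lambda>n s. (d n s, d' n s)) (\<lambda>s. (c s, c' s)) sequentially"
  proof (rule uniform_limitI)
    fix r :: real assume "0 < r"
    then have "\<forall>\<^sub>F n in sequentially. \<forall>s\<in>{0..1}. dist (d n s) (c s) < r / 2"
      "\<forall>\<^sub>F n in sequentially. \<forall>s\<in>{0..1}. dist (d' n s) (c' s) < r / 2"
      by (simp_all only: uniform_limitD[OF lim(1)] uniform_limitD[OF lim(2)] half_gt_zero)
    then show "\<forall>\<^sub>F n in sequentially. \<forall>s\<in>{0..1}. dist (d n s, d' n s) (c s, c' s) < r"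
    proof eventually_elim
      case (elim n)
      have "dist (x, v) (y, w) \<le> dist x y + dist v w" for x v y w :: "real^'n"
        unfolding dist_Pair_Pair by (rule sqrt_sum_squares_le_sum) simp_all
      with elim show ?case by (smt (verit, ccfv_threshold) field_sum_of_halves)
    qed
  qed
  have ev: "\<forall>\<^sub>F n in sequentially. \<forall>s\<in>{0..1}. (d n s, d' n s) \<in> K"
    using uniform_limitD[OF limp zero_less_one]
  proof eventually_elim
    case (elim n)
    show ?case
    proof
      fix s :: real assume s: "s \<in> {0..1}"
      have "(d n s, d' n s) = (c s, c' s) + ((d n s, d' n s) - (c s, c' s))" by simp
      moreover have "(d n s, d' n s) - (c s, c' s) \<in> cball 0 1"
        using elim s unfolding mem_cball dist_0_norm by (metis dist_norm less_imp_le)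
      ultimately show "(d n s, d' n s) \<in> K" unfolding K_def using s by blast
    qed
  qed
  have "uniform_limit {0..1} (\<lambda>n s. F (d n s, d' n s)) (\<lambda>s. F (c s, c' s)) sequentially"
    by (rule uniform_limit_compose_uniformly_continuous_on[OF limp uc ev compact_imp_closed[OF K]])
  then have "uniform_limit {0..1} (\<lambda>n s. wnorm2 (P (d n s)) (d' n s))
      (\<lambda>s. wnorm2 (P (c s)) (c' s)) sequentially"
    by (simp add: F_def)
  from uniform_limit_integral[OF this continuous_on_energy_density[OF d(2) P(1)]]
  obtain I J where IJ: "\<And>n. ((\<lambda>s. wnorm2 (P (d n s)) (d' n s)) has_integral I n) {0..1}"
      "((\<lambda>s. wnorm2 (P (c s)) (c' s)) has_integral J) {0..1}" "I \<longlonglongrightarrow> J"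
    by auto
  have "min_energy P (c 0) (c 1) \<le> I n" for n
  proof -
    have "I n = energy P (d n)" by (simp add: energy_C1_path[OF d(2)] integral_unique[OF IJ(1)])
    then show ?thesis
      using min_energy_le[of P "c 0" "c 1" "d n"] P(2) d by (simp add: smooth_path_between_def)
  qed
  then have "min_energy P (c 0) (c 1) \<le> J"
    using IJ(3) by (intro LIMSEQ_le_const[of I]) auto
  then show ?thesis using IJ(2) by (simp add: integral_unique)
qed

section \<open>Derivatives and block matrices\<close>

lemma jacobian_mult:
  fixes g :: "real^'a \<Rightarrow> real^'b"
  assumes "(g has_derivative g') (at x)"
  shows "jacobian g (at x) *v v = g' v"
  unfolding jacobian_def frechet_derivative_at[OF assms, symmetric]
  by (rule matrix_works[OF has_derivative_linear[OF assms, folded linear_matrix_vector_mul_eq]])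

text \<open>Additivity of the total derivative; the input increment is zero because the two
  trajectories to be compared share their input.\<close>

lemma partial_jacobians_mult:
  fixes f :: "(real^'n) \<times> (real^'m) \<times> (real^'q) \<Rightarrow> real^'k"
  assumes f: "(f has_derivative f') (at (x, u, w))"
  shows "jacobian (\<lambda>x. f (x, u, w)) (at x) *v a + jacobian (\<lambda>w. f (x, u, w)) (at w) *v b
    = f' (a, 0, b)"
proof -
  have "((\<lambda>x. f (x, u, w)) has_derivative (\<lambda>a. f' (a, 0, 0))) (at x)"
    by (rule has_derivative_compose[of "\<lambda>x. (x, u, w)" "\<lambda>a. (a, 0, 0)" x UNIV f f'])
       (auto intro!: has_derivative_Pair has_derivative_const has_derivative_ident f)
  moreover have "((\<lambda>w. f (x, u, w)) has_derivative (\<lambda>b. f' (0, 0, b))) (at w)"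
    by (rule has_derivative_compose[of "\<lambda>w. (x, u, w)" "\<lambda>b. (0, 0, b)" w UNIV f f'])
       (auto intro!: has_derivative_Pair has_derivative_const has_derivative_ident f)
  moreover have "f' (a, 0, b) = f' (a, 0, 0) + f' (0, 0, b)"
    using linear_add[OF has_derivative_linear[OF f], of "(a, 0, 0)" "(0, 0, b)"] by simp
  ultimately show ?thesis by (simp add: jacobian_mult)
qed

lemma wnorm2_block_matrix:
  fixes A :: "real^'a^'a" and D :: "real^'b^'b"
  shows "wnorm2 (block_matrix A B C D) (\<chi> i. case i of Inl k \<Rightarrow> a $ k | Inr k \<Rightarrow> b $ k)
    = a \<bullet> (A *v a) + a \<bullet> (B *v b) + b \<bullet> (C *v a) + b \<bullet> (D *v b)"
proof -
  have sum: "sum g UNIV = (\<Sum>k\<in>UNIV. g (Inl k)) + (\<Sum>k\<in>UNIV. g (Inr k))"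
    for g :: "'a + 'b \<Rightarrow> real"
    using sum.Plus[of "UNIV :: 'a set" "UNIV :: 'b set" g] by simp
  show ?thesis
    by (simp add: wnorm2_def block_matrix_def inner_vec_def matrix_vector_mult_def sum
        ring_distribs sum.distrib)
qed

text \<open>Testing the matrix inequality on the stacked vector of \<open>a\<close> and
  \<open>b\<close> gives the infinitesimal decrease condition. Later \<open>a\<close> and
  \<open>b\<close> are the velocities of the state and of the disturbance, and \<open>M\<close> and
  \<open>N\<close> the metric at the successor and at the current state.\<close>

lemma dissipation_from_LMI:
  fixes A :: "real^'n^'k" and B :: "real^'q^'k" and C :: "real^'n^'p" and D :: "real^'q^'p"
  assumes "block_matrix
      (transpose A ** M ** A - \<eta> *\<^sub>R N - transpose C ** R ** C)
      (transpose A ** M ** B - transpose C ** R ** D)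
      (transpose B ** M ** A - transpose D ** R ** C)
      (transpose B ** M ** B - Q - transpose D ** R ** D) \<preceq> 0"
  shows "wnorm2 M (A *v a + B *v b)
    \<le> \<eta> * wnorm2 N a + wnorm2 Q b + wnorm2 R (C *v a + D *v b)"
proof -
  let ?z = "\<chi> i. case i of Inl k \<Rightarrow> a $ k | Inr k \<Rightarrow> b $ k"
  have "wnorm2 (block_matrix
      (transpose A ** M ** A - \<eta> *\<^sub>R N - transpose C ** R ** C)
      (transpose A ** M ** B - transpose C ** R ** D)
      (transpose B ** M ** A - transpose D ** R ** C)
      (transpose B ** M ** B - Q - transpose D ** R ** D)) ?z \<le> wnorm2 0 ?z"
    by (rule loewner_le_imp_wnorm2_le[OF assms])
  also have "\<dots> = 0" by (simp add: wnorm2_def)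
  finally show ?thesis
    unfolding wnorm2_block_matrix
    unfolding matrix_vector_mult_diff_rdistrib inner_diff_right
      inner_transpose_mult wnorm2_def matrix_vector_right_distrib inner_add_left inner_add_right
      scaleR_matrix_vector_assoc[symmetric] inner_scaleR_right
    by linarith
qed

section \<open>Metrics splitting off a constant block\<close>

lemma sum_sum_restrict:
  fixes g :: "'n::finite \<Rightarrow> 'n \<Rightarrow> real"
  shows "(\<Sum>i\<in>UNIV. \<Sum>j\<in>UNIV. if i \<in> S \<and> j \<in> S then g i j else 0) = (\<Sum>i\<in>S. \<Sum>j\<in>S. g i j)"
proof -
  have "(\<Sum>j\<in>UNIV. if i \<in> S \<and> j \<in> S then g i j else 0)
      = (if i \<in> S then \<Sum>j\<in>S. g i j else 0)" for i
    by (simp add: sum.If_cases)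
  then show ?thesis by (simp add: sum.If_cases)
qed

text \<open>The mixed blocks vanish and the second block is reindexed along \<open>e\<close>. Its
  contribution depends only on the velocity, not on the base point \<open>z\<close>.\<close>

lemma wnorm2_split_metric:
  fixes e :: "'p::finite \<Rightarrow> 'n::finite"
  assumes "inj e"
  shows "wnorm2 (split_metric e Px Py z) v
    = (\<Sum>i\<in>-range e. \<Sum>j\<in>-range e. v $ i * (Px (rest_coords e z) i j * v $ j))
      + wnorm2 Py (\<chi> k. v $ e k)"
proof -
  have "wnorm2 (split_metric e Px Py z) v
      = (\<Sum>i\<in>UNIV. \<Sum>j\<in>UNIV.
          (if i \<in> -range e \<and> j \<in> -range e then v $ i * (Px (rest_coords e z) i j * v $ j) else 0)
        + (if i \<in> range e \<and> j \<in> range e then v $ i * (Py $ inv e i $ inv e j * v $ j) else 0))"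
    unfolding wnorm2_def inner_vec_def matrix_vector_mult_def split_metric_def
    by (auto simp: sum_distrib_left intro!: sum.cong)
  also have "\<dots> = (\<Sum>i\<in>-range e. \<Sum>j\<in>-range e. v $ i * (Px (rest_coords e z) i j * v $ j))
      + (\<Sum>i\<in>range e. \<Sum>j\<in>range e. v $ i * (Py $ inv e i $ inv e j * v $ j))"
    unfolding sum.distrib by (intro arg_cong2[where f = "(+)"] sum_sum_restrict)
  also have "(\<Sum>i\<in>range e. \<Sum>j\<in>range e. v $ i * (Py $ inv e i $ inv e j * v $ j))
      = wnorm2 Py (\<chi> k. v $ e k)"
    using assms
    by (simp add: sum.reindex wnorm2_def inner_vec_def matrix_vector_mult_def sum_distrib_left)
  finally show ?thesis .
qed

text \<open>Symmetry is read off the entries with indices in \<open>range e\<close>; positivity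
  follows by testing with vectors extended by zero.\<close>

lemma pos_def_split_metric_block:
  fixes e :: "'p::finite \<Rightarrow> 'n::finite"
  assumes "inj e" "pos_def (split_metric e Px Py z)"
  shows "pos_def Py"
  unfolding pos_def_def
proof (intro conjI allI impI)
  let ?S = "split_metric e Px Py z"
  have entry: "?S $ e k $ e l = Py $ k $ l" for k l
    using assms(1) by (simp add: split_metric_def)
  have "transpose ?S $ e k $ e l = ?S $ e k $ e l" for k l
    using assms(2) by (simp add: pos_def_def)
  then have "Py $ l $ k = Py $ k $ l" for k l
    by (simp add: transpose_def entry)
  then show "transpose Py = Py"
    by (simp add: transpose_def vec_eq_iff)
next
  fix v :: "real^'p" assume "v \<noteq> 0"
  define V where "V = (\<chi> i. if i \<in> range e then v $ inv e i else 0)"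
  have V: "V $ e k = v $ k" for k using assms(1) by (simp add: V_def)
  with \<open>v \<noteq> 0\<close> have "V \<noteq> 0" by (metis vec_eq_iff zero_index)
  then have "0 < wnorm2 (split_metric e Px Py z) V"
    using assms(2) by (simp add: pos_def_def wnorm2_def)
  also have "\<dots> = wnorm2 Py v"
    unfolding wnorm2_split_metric[OF assms(1)] V by (simp add: V_def)
  finally show "0 < v \<bullet> (Py *v v)" by (simp add: wnorm2_def)
qed

text \<open>The chain rule applied to the identity \<open>\<phi> (inv \<phi> z) = z\<close>.\<close>

lemma inverse_derivative_right:
  fixes \<phi> :: "'a::real_normed_vector \<Rightarrow> 'a"
  assumes "surj \<phi>" and \<phi>: "\<And>x. (\<phi> has_derivative \<phi>' x) (at x)"
    and \<psi>: "\<And>z. (inv \<phi> has_derivative \<psi>' z) (at z)"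
  shows "\<phi>' (inv \<phi> z) (\<psi>' z v) = v"
proof -
  have "((\<lambda>z. \<phi> (inv \<phi> z)) has_derivative (\<lambda>v. \<phi>' (inv \<phi> z) (\<psi>' z v))) (at z)"
    by (rule has_derivative_compose[OF \<psi> \<phi>])
  moreover have "(\<lambda>z. \<phi> (inv \<phi> z)) = (\<lambda>z. z)"
    using assms(1) by (simp add: surj_f_inv_f)
  ultimately show ?thesis
    using has_derivative_unique[OF has_derivative_ident] by metis
qed

text \<open>Conjugation with the right inverse \<open>K\<close> recovers \<open>S\<close>, which
  gives symmetry. For positivity the test vector is \<open>K *v v\<close>, which \<open>J\<close>
  sends back to \<open>v\<close>.\<close>

lemma pos_def_congruence_cancel:
  fixes S :: "real^'n^'n"
  assumes "pos_def (transpose J ** S ** J)" "J ** K = mat 1"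
  shows "pos_def S"
proof -
  have "S = transpose (J ** K) ** S ** (J ** K)" by (simp add: assms(2))
  then have S: "S = transpose K ** (transpose J ** S ** J) ** K"
    by (simp only: matrix_transpose_mul matrix_mul_assoc)
  have "transpose S = S"
  proof -
    have "transpose (transpose J ** S ** J) = transpose J ** S ** J"
      using assms(1) by (simp add: pos_def_def)
    then have "transpose (transpose K ** (transpose J ** S ** J) ** K)
        = transpose K ** (transpose J ** S ** J) ** K"
      by (simp only: matrix_transpose_mul transpose_transpose matrix_mul_assoc)
    then show ?thesis using S by simp
  qed
  moreover have "0 < v \<bullet> (S *v v)" if "v \<noteq> 0" for v
  proof -
    have "J *v (K *v v) = v" by (simp add: matrix_vector_mul_assoc assms(2))
    moreover from this that have "K *v v \<noteq> 0" by auto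
    then have "0 < wnorm2 (transpose J ** S ** J) (K *v v)"
      using assms(1) by (simp add: pos_def_def wnorm2_def)
    ultimately show ?thesis by (simp add: wnorm2_congruence) (simp add: wnorm2_def)
  qed
  ultimately show ?thesis by (simp add: pos_def_def)
qed

text \<open>Replacing the \<open>e\<close>-coordinates of a geodesic by straight lines leaves the contribution of the
  other coordinates to the energy unchanged, so minimality forces them to have been straight.\<close>

lemma geodesic_straight_coordinates:
  fixes \<phi> :: "real^'n \<Rightarrow> real^'n" and e :: "'p::finite \<Rightarrow> 'n"
    and \<phi>' \<psi>' :: "real^'n \<Rightarrow> (real^'n) \<Rightarrow>\<^sub>L (real^'n)"
  assumes e: "inj e" and "bij \<phi>"
    and \<phi>: "\<And>x. (\<phi> has_derivative \<phi>' x) (at x)" "continuous_on UNIV \<phi>'"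
    and \<psi>: "\<And>z. (inv \<phi> has_derivative \<psi>' z) (at z)" "continuous_on UNIV \<psi>'"
    and P: "continuous_on UNIV P" "\<And>x. pos_def (P x)"
    and split: "\<And>x. P x = transpose (jacobian \<phi> (at x)) ** split_metric e Px Py (\<phi> x)
                           ** jacobian \<phi> (at x)"
    and geo: "minimizing_geodesic P x y c" and c: "C1_path c c'" and s: "s \<in> {0..1}"
  shows "\<phi>' (c s) (c' s) $ e k = (\<phi> y - \<phi> x) $ e k"
proof -
  have c01: "c 0 = x" "c 1 = y"
    using geo by (auto simp: minimizing_geodesic_def smooth_path_between_def)
  have semi: "pos_semidef (P x)" for x by (simp add: P(2) pos_def_imp_pos_semidef)
  note \<phi>\<psi> = inverse_derivative_right[OF bij_is_surj[OF \<open>bij \<phi>\<close>] \<phi>(1) \<psi>(1)]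
  have \<phi>_inv: "\<phi> (inv \<phi> z) = z" "inv \<phi> (\<phi> x) = x" for z x
    using \<open>bij \<phi>\<close> by (simp_all add: bij_is_surj bij_is_inj surj_f_inv_f)
  \<comment> \<open>In the coordinates \<open>\<phi>\<close> the velocity \<open>v\<close> becomes
    \<open>\<phi>' x v\<close> and the metric becomes block diagonal.\<close>
  have density: "wnorm2 (P x) v = wnorm2 (split_metric e Px Py (\<phi> x)) (\<phi>' x v)" for x v
    by (simp add: split wnorm2_congruence jacobian_mult[OF \<phi>(1)])
  \<comment> \<open>As \<open>Py\<close> is constant, one point is enough, here the preimage of 0;
    the derivative of the inverse map supplies the right inverse of the Jacobian.\<close>
  have Py: "pos_def Py"
  proof -
    let ?x = "inv \<phi> 0"
    have "jacobian \<phi> (at ?x) ** matrix (blinfun_apply (\<psi>' 0)) = mat 1"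
      unfolding matrix_eq
      by (simp add: jacobian_mult[OF \<phi>(1)] fun_cong[OF matrix_vector_mul(3)[OF blinfun.bounded_linear_right]] \<phi>\<psi>
          flip: matrix_vector_mul_assoc)
    with P(2)[of ?x] have "pos_def (split_metric e Px Py (\<phi> ?x))"
      unfolding split[of ?x] by (rule pos_def_congruence_cancel)
    then show ?thesis by (rule pos_def_split_metric_block[OF e])
  qed
  define out :: "real^'n \<Rightarrow> real^'p" where "out v = (\<chi> k. v $ e k)" for v
  define proj :: "real^'n \<Rightarrow> real^'n" where "proj v = (\<chi> i. if i \<in> range e then v $ i else 0)" for v
  have "linear out" "linear proj"
    unfolding out_def proj_def by (auto intro!: linearI simp: vec_eq_iff)
  then have lin: "bounded_linear out" "bounded_linear proj" "bounded_linear (\<lambda>v. v - proj v)"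
    by (auto simp: linear_conv_bounded_linear intro: bounded_linear_sub bounded_linear_ident)
  define z z' where "z s = \<phi> (c s)" and "z' s = blinfun_apply (\<phi>' (c s)) (c' s)" for s
  have z: "C1_path z z'" unfolding z_def z'_def by (rule C1_path_compose[OF c \<phi>])
  \<comment> \<open>The competitor in the new coordinates: outside \<open>range e\<close> it follows
    \<open>z\<close>, while the remaining coordinates move uniformly from start to end.\<close>
  define \<zeta> where "\<zeta> s = (z s - proj (z s)) + (proj (z 0) + s *\<^sub>R proj (z 1 - z 0))" for s
  define \<zeta>' where "\<zeta>' s = (z' s - proj (z' s)) + proj (z 1 - z 0)" for s
  have \<zeta>: "C1_path \<zeta> \<zeta>'"
    unfolding \<zeta>_def \<zeta>'_def by (intro C1_path_add C1_path_linear[OF z lin(3)] C1_path_line)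
  have \<zeta>01: "\<zeta> 0 = z 0" "\<zeta> 1 = z 1"
    by (simp_all add: \<zeta>_def linear_diff[OF \<open>linear proj\<close>])
  define d d' where "d s = inv \<phi> (\<zeta> s)" and "d' s = blinfun_apply (\<psi>' (\<zeta> s)) (\<zeta>' s)" for s
  have d: "C1_path d d'" unfolding d_def d'_def by (rule C1_path_compose[OF \<zeta> \<psi>])
  have d01: "d 0 = x" "d 1 = y" by (simp_all add: d_def \<zeta>01 z_def \<phi>_inv c01)
  have eq: "wnorm2 (P (d s)) (d' s)
      = wnorm2 (P (c s)) (c' s) - wnorm2 Py (out (z' s)) + wnorm2 Py (out (z 1 - z 0))" for s
  proof -
    \<comment> \<open>Position and velocity agree with those of \<open>z\<close> outside
      \<open>range e\<close>, so the \<open>Px\<close> contributions coincide and only the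
      \<open>Py\<close> terms differ.\<close>
    have "rest_coords e (\<zeta> s) = rest_coords e (z s)"
      by (auto simp: rest_coords_def restrict_def \<zeta>_def proj_def)
    moreover have "\<zeta>' s $ i = z' s $ i" if "i \<in> - range e" for i
      using that by (auto simp: \<zeta>'_def proj_def)
    moreover have "out (\<zeta>' s) = out (z 1 - z 0)"
      by (simp add: out_def \<zeta>'_def proj_def vec_eq_iff)
    moreover have "wnorm2 (P (d s)) (d' s) = wnorm2 (split_metric e Px Py (\<zeta> s)) (\<zeta>' s)"
      unfolding density by (simp add: d_def d'_def \<phi>_inv \<phi>\<psi>)
    moreover have "wnorm2 (P (c s)) (c' s) = wnorm2 (split_metric e Px Py (z s)) (z' s)"
      unfolding density by (simp add: z_def z'_def)
    ultimately show ?thesis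
      unfolding wnorm2_split_metric[OF e] out_def[symmetric] by simp
  qed
  have out: "C1_path (\<lambda>s. out (z s)) (\<lambda>s. out (z' s))" by (rule C1_path_linear[OF z lin(1)])
  have int_P: "(\<lambda>s. wnorm2 (P (c s)) (c' s)) integrable_on {0..1}"
    by (intro integrable_continuous_real continuous_on_energy_density[OF c P(1)])
  have int_out: "(\<lambda>s. wnorm2 Py (out (z' s))) integrable_on {0..1}"
    using out unfolding C1_path_def
    by (intro integrable_continuous_real) (auto intro!: continuous_intros)
  \<comment> \<open>The path \<open>c\<close> is minimal among smooth paths and \<open>d\<close> is
    merely continuously differentiable, so the comparison passes through \<open>min_energy\<close>.
    The energy of \<open>c\<close> then cancels, which leaves the equality case of Jensen's
    inequality for the \<open>e\<close>-coordinates.\<close>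
  have "energy P c \<le> min_energy P x y"
    using geo by (intro le_min_energy) (auto simp: minimizing_geodesic_def)
  also have "\<dots> \<le> integral {0..1} (\<lambda>s. wnorm2 (P (d s)) (d' s))"
    using min_energy_le_C1_path[OF P(1) semi d] by (simp add: d01)
  also have "\<dots> = energy P c - integral {0..1} (\<lambda>s. wnorm2 Py (out (z' s)))
      + wnorm2 Py (out (z 1 - z 0))"
    unfolding eq energy_C1_path[OF c]
    using has_integral_const_real[of "wnorm2 Py (out (z 1 - z 0))" 0 1]
    by (intro integral_unique has_integral_add has_integral_diff integrable_integral int_P int_out)
       simp
  finally have "integral {0..1} (\<lambda>s. wnorm2 Py (out (z' s))) \<le> wnorm2 Py (out (z 1) - out (z 0))"
    by (simp add: linear_diff[OF \<open>linear out\<close>])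
  from straight_if_integral_wnorm2_le[OF out Py this s]
  have "out (z' s) $ k = (out (z 1) - out (z 0)) $ k" by simp
  then show ?thesis by (simp add: out_def z_def z'_def c01)
qed

text \<open>In the expansion of \<open>v - v'\<close> along the standard basis, every term has
  either a zero coordinate or a basis vector annihilated by \<open>L\<close>. Applied to the linear
  part of the output map, it shows that the output rate depends only on coordinates traversed at
  constant speed and on the disturbance.\<close>

lemma linear_eq_if_range_coords_eq:
  fixes L :: "(real^'n) \<times> 'b::euclidean_space \<Rightarrow> 'c::euclidean_space"
  assumes L: "linear L" "\<And>i. i \<notin> range e \<Longrightarrow> L (axis i 1, 0) = 0"
    and "\<And>k. v $ e k = v' $ e k"
  shows "L (v, b) = L (v', b)"
proof -
  define \<delta> where "\<delta> = v - v'"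
  have "linear (\<lambda>a. (a, 0 :: 'b))" by (auto intro: linearI)
  from linear_compose[OF this L(1)] have L0: "linear (\<lambda>a. L (a, 0))" by (simp add: o_def)
  have "L (\<delta>, 0) = L (\<Sum>i\<in>UNIV. (\<delta> $ i) *\<^sub>R axis i 1, 0)"
    by (simp add: basis_expansion flip: scalar_mult_eq_scaleR)
  also have "\<dots> = (\<Sum>i\<in>UNIV. \<delta> $ i *\<^sub>R L (axis i 1, 0))"
    by (simp add: linear_sum[OF L0] linear_scale[OF L0])
  also have "\<dots> = 0"
  proof (intro sum.neutral ballI)
    fix i
    show "\<delta> $ i *\<^sub>R L (axis i 1, 0) = 0"
      using L(2)[of i] assms(3) by (cases "i \<in> range e") (auto simp: \<delta>_def)
  qed
  finally show ?thesis
    using linear_diff[OF L(1), of "(v, b)" "(v', b)"] by (simp add: \<delta>_def)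
qed

section \<open>The least energy between two states as a Lyapunov function\<close>

theorem theorem2:
  fixes f :: "(real^'n) \<times> (real^'m) \<times> (real^'q) \<Rightarrow> real^'n"
    and h :: "(real^'n) \<times> (real^'m) \<times> (real^'q) \<Rightarrow> real^'p"
    and X :: "(real^'n) set" and U :: "(real^'m) set"
    and W :: "(real^'q) set" and Y :: "(real^'p) set"
    and e :: "'p \<Rightarrow> 'n"
    and \<phi> :: "real^'n \<Rightarrow> real^'n"
    and P :: "real^'n \<Rightarrow> real^'n^'n"
    and Px :: "('n \<Rightarrow> real) \<Rightarrow> 'n \<Rightarrow> 'n \<Rightarrow> real" and Py :: "real^'p^'p"
    and \<eta> :: real
    and P1 P2 :: "real^'n^'n" and Q :: "real^'q^'q" and R :: "real^'p^'p"
  assumes "inj e"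
    and "C1_map f" and "C1_map h"
    and "C1_diffeomorphism \<phi>"
    and hbar_affine: "\<And>u. affine_map (\<lambda>(z, w). h (inv \<phi> z, u, w))"
    and hbar_partial: "\<And>i z u w. i \<notin> range e \<Longrightarrow>
          ((\<lambda>t. h (inv \<phi> (z + t *\<^sub>R axis i 1), u, w)) has_vector_derivative 0) (at 0)"
    and "riemannian_metric P"
    and P_split: "\<And>x. P x = transpose (jacobian \<phi> (at x)) ** split_metric e Px Py (\<phi> x)
                              ** jacobian \<phi> (at x)"
    and "weakly_geodesically_convex P X"
    and hull_bounded: "bounded (P ` (convex hull X))"
    and "convex W"
    and "0 \<le> \<eta>" and "\<eta> < 1"
    and "pos_def P1" and "pos_def P2" and "pos_semidef Q" and "pos_semidef R"
    and LMI: "\<And>x u w. x \<in> X \<Longrightarrow> u \<in> U \<Longrightarrow> w \<in> W \<Longrightarrow>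
          (let A = jacobian (\<lambda>x. f (x, u, w)) (at x);
               B = jacobian (\<lambda>w. f (x, u, w)) (at w);
               C = jacobian (\<lambda>x. h (x, u, w)) (at x);
               D = jacobian (\<lambda>w. h (x, u, w)) (at w);
               Pp = P (f (x, u, w))
           in block_matrix
                (transpose A ** Pp ** A - \<eta> *\<^sub>R P x - transpose C ** R ** C)
                (transpose A ** Pp ** B - transpose C ** R ** D)
                (transpose B ** Pp ** A - transpose D ** R ** C)
                (transpose B ** Pp ** B - Q - transpose D ** R ** D) \<preceq> 0)"
    and P_bounds: "\<And>x u w. x \<in> X \<Longrightarrow> u \<in> U \<Longrightarrow> w \<in> W \<Longrightarrow> P1 \<preceq> P x \<and> P x \<preceq> P2"
  shows "\<exists>V. quad_bounded_dIOSS_Lyapunov f h X U W Y V"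
proof -
  have P_pd: "pos_def (P x)" for x
    using \<open>riemannian_metric P\<close> by (simp add: riemannian_metric_def)
  then have P_psd: "pos_semidef (P x)" for x by (rule pos_def_imp_pos_semidef)
  have P_cont: "continuous_on UNIV P"
    using \<open>riemannian_metric P\<close> unfolding riemannian_metric_def
    by (blast intro: differentiable_imp_continuous_on smooth_on_imp_differentiable_on)
  obtain F where F: "\<And>x. (f has_derivative blinfun_apply (F x)) (at x)" "continuous_on UNIV F"
    using \<open>C1_map f\<close> unfolding C1_map_def by blast
  obtain H where H: "\<And>x. (h has_derivative blinfun_apply (H x)) (at x)" "continuous_on UNIV H"
    using \<open>C1_map h\<close> unfolding C1_map_def by blast
  obtain \<phi>' where \<phi>: "\<And>x. (\<phi> has_derivative blinfun_apply (\<phi>' x)) (at x)" "continuous_on UNIV \<phi>'"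
    using \<open>C1_diffeomorphism \<phi>\<close> unfolding C1_diffeomorphism_def C1_map_def by blast
  obtain \<psi>' where \<psi>: "\<And>z. (inv \<phi> has_derivative blinfun_apply (\<psi>' z)) (at z)"
      "continuous_on UNIV \<psi>'"
    using \<open>C1_diffeomorphism \<phi>\<close> unfolding C1_diffeomorphism_def C1_map_def by blast
  have "bij \<phi>" using \<open>C1_diffeomorphism \<phi>\<close> by (simp add: C1_diffeomorphism_def)
  \<comment> \<open>The upper estimate runs along segments, which may leave \<open>X\<close>; hence
    the bound is taken over the convex hull.\<close>
  obtain K where K: "0 < K" "\<forall>M\<in>P ` (convex hull X). \<forall>v. wnorm2 M v \<le> K * (norm v)\<^sup>2"
    by (rule bounded_wnorm2_le[OF hull_bounded])
  \<comment> \<open>A minimizer has energy at most the infimum. Staying in \<open>X\<close> makes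
    the matrix inequality and the metric bounds available all along it.\<close>
  have geodesic: "\<exists>c c'. minimizing_geodesic P x y c \<and> C1_path c c' \<and> c 0 = x \<and> c 1 = y
      \<and> (\<forall>s\<in>{0..1}. c s \<in> X) \<and> energy P c \<le> min_energy P x y" if xy: "x \<in> X" "y \<in> X" for x y
  proof -
    obtain c where c: "minimizing_geodesic P x y c" "\<forall>s\<in>{0..1}. c s \<in> X"
      using \<open>weakly_geodesically_convex P X\<close> xy unfolding weakly_geodesically_convex_def by blast
    have ends: "smooth_on {0..1} c" "c 0 = x" "c 1 = y"
      using c(1) by (simp_all add: minimizing_geodesic_def smooth_path_between_def)
    obtain c' where c': "C1_path c c'" using ends(1) by (rule smooth_on_C1_path)
    have "energy P c \<le> min_energy P x y"
      using c(1) by (intro le_min_energy) (simp add: minimizing_geodesic_def)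
    then show ?thesis by (intro exI[of _ c] exI[of _ c'] conjI c c' ends)
  qed
  \<comment> \<open>Jensen's inequality for the constant metric \<open>P1\<close> along the
    geodesic. The bounds on \<open>P\<close> are given at triples, so elements of \<open>U\<close>
    and \<open>W\<close> must be supplied.\<close>
  have lower: "wnorm2 P1 (x - y) \<le> min_energy P x y"
    if "x \<in> X" "y \<in> X" "u \<in> U" "w \<in> W" for x y u w
  proof -
    obtain c c' where c: "C1_path c c'" "c 0 = x" "c 1 = y" "\<forall>s\<in>{0..1}. c s \<in> X"
        "energy P c \<le> min_energy P x y"
      using geodesic[OF \<open>x \<in> X\<close> \<open>y \<in> X\<close>] by blast
    have "wnorm2 P1 (y - x) \<le> integral {0..1} (\<lambda>s. wnorm2 P1 (c' s))"
      using wnorm2_displacement_le_integral[OF c(1) pos_def_imp_pos_semidef[OF \<open>pos_def P1\<close>]]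
      by (simp add: c)
    also have "\<dots> \<le> integral {0..1} (\<lambda>s. wnorm2 (P (c s)) (c' s))"
    proof (rule integral_le)
      show "(\<lambda>s. wnorm2 P1 (c' s)) integrable_on {0..1}"
        using c(1) unfolding C1_path_def
        by (intro integrable_continuous_real) (auto intro!: continuous_intros)
      show "(\<lambda>s. wnorm2 (P (c s)) (c' s)) integrable_on {0..1}"
        by (intro integrable_continuous_real continuous_on_energy_density[OF c(1) P_cont])
      show "wnorm2 P1 (c' s) \<le> wnorm2 (P (c s)) (c' s)" if "s \<in> {0..1}" for s
        using P_bounds c(4) that \<open>u \<in> U\<close> \<open>w \<in> W\<close> by (blast intro: loewner_le_imp_wnorm2_le)
    qed
    also have "\<dots> = energy P c" by (simp add: energy_C1_path[OF c(1)])
    finally show ?thesis using c(5) by (simp add: wnorm2_minus_commute)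
  qed
  \<comment> \<open>The segment is a competitor of constant velocity, and \<open>K\<close> bounds
    the metric along it.\<close>
  have upper: "min_energy P x y \<le> wnorm2 (K *\<^sub>R mat 1) (x - y)" if "x \<in> X" "y \<in> X" for x y
  proof -
    let ?c = "\<lambda>s. x + s *\<^sub>R (y - x)"
    have "min_energy P x y \<le> integral {0..1} (\<lambda>s. wnorm2 (P (?c s)) (y - x))"
      using min_energy_le_C1_path[OF P_cont P_psd C1_path_line[of x "y - x"]] by simp
    also have "\<dots> \<le> integral {0..1::real} (\<lambda>_. K * (norm (y - x))\<^sup>2)"
    proof (rule integral_le)
      show "(\<lambda>s. wnorm2 (P (?c s)) (y - x)) integrable_on {0..1}"
        by (intro integrable_continuous_real continuous_on_energy_density[OF C1_path_line P_cont])
      show "wnorm2 (P (?c s)) (y - x) \<le> K * (norm (y - x))\<^sup>2" if "s \<in> {0..1}" for s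
      proof (intro K(2)[rule_format] imageI)
        have "?c s = (1 - s) *\<^sub>R x + s *\<^sub>R y" by (simp add: algebra_simps)
        also have "\<dots> \<in> convex hull X"
          using that \<open>x \<in> X\<close> \<open>y \<in> X\<close>
          by (intro convexD[OF convex_convex_hull]) (auto intro: hull_inc)
        finally show "?c s \<in> convex hull X" .
      qed
    qed auto
    finally show ?thesis by (simp add: wnorm2_scaled_identity norm_minus_commute)
  qed
  have decrease: "min_energy P (f (x, u, w)) (f (y, u, w2))
      \<le> \<eta> * min_energy P x y + wnorm2 Q (w - w2) + wnorm2 R (h (x, u, w) - h (y, u, w2))"
    if mem: "x \<in> X" "y \<in> X" "u \<in> U" "w \<in> W" "w2 \<in> W" for x y u w w2
  proof -
    obtain c c' where geo: "minimizing_geodesic P x y c" and c: "C1_path c c'" "c 0 = x" "c 1 = y"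
        "\<forall>s\<in>{0..1}. c s \<in> X" "energy P c \<le> min_energy P x y"
      using geodesic[OF \<open>x \<in> X\<close> \<open>y \<in> X\<close>] by blast
    define \<Delta> where "\<Delta> = w2 - w"
    \<comment> \<open>The disturbances are joined by a segment, which convexity keeps in
      \<open>W\<close>; its constant velocity makes the \<open>Q\<close> term constant.\<close>
    define \<omega> where "\<omega> s = w + s *\<^sub>R \<Delta>" for s :: real
    have \<omega>_mem: "\<omega> s \<in> W" if "s \<in> {0..1}" for s
    proof -
      have "\<omega> s = (1 - s) *\<^sub>R w + s *\<^sub>R w2" by (simp add: \<omega>_def \<Delta>_def algebra_simps)
      then show ?thesis using that mem convexD[OF \<open>convex W\<close>, of w w2 "1 - s" s] by simp
    qed
    define p where "p s = (c s, u, \<omega> s)" for s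
    define p' where "p' s = (c' s, 0 :: real^'m, \<Delta>)" for s
    have \<omega>: "C1_path \<omega> (\<lambda>_. \<Delta>)" unfolding \<omega>_def by (rule C1_path_line)
    have p: "C1_path p p'"
      unfolding p_def p'_def using C1_path_line[of u 0] by (intro C1_path_Pair c(1) \<omega>) simp
    note fp = C1_path_compose[OF p F] and hp = C1_path_compose[OF p H]
    \<comment> \<open>This is what allows the output term to be integrated exactly: \<open>L\<close>
      ignores the coordinates outside \<open>range e\<close>, and the geodesic moves uniformly in
      the others.\<close>
    have rate: "H (p s) (p' s) = h (y, u, w2) - h (x, u, w)" if "s \<in> {0..1}" for s
    proof -
      obtain L b where L: "linear L" and hbar: "\<And>z w. h (inv \<phi> z, u, w) = L (z, w) + b"
        using hbar_affine[of u] unfolding affine_map_def by auto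
      have L_axis: "L (axis i 1, 0) = 0" if "i \<notin> range e" for i
      proof -
        \<comment> \<open>The partial derivative of an affine map is the same everywhere, so it is
          evaluated at the origin.\<close>
        have "((\<lambda>t. L (t *\<^sub>R axis i 1, 0) + b) has_vector_derivative 0) (at 0)"
          using hbar_partial[OF that, of 0 u 0] by (simp add: hbar)
        moreover have "L (t *\<^sub>R axis i 1, 0) = t *\<^sub>R L (axis i 1, 0)" for t
          using linear_scale[OF L, of t "(axis i 1, 0)"] by simp
        moreover have "((\<lambda>t. t *\<^sub>R L (axis i 1, 0) + b) has_vector_derivative L (axis i 1, 0)) (at 0)"
          by (auto intro!: derivative_eq_intros)
        ultimately show ?thesis using vector_derivative_unique_at by fastforce
      qed
      have inv: "inv \<phi> (\<phi> a) = a" for a using \<open>bij \<phi>\<close> by (simp add: bij_is_inj)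
      have hL: "h (a, u, v) = L (\<phi> a, v) + b" for a v using hbar[of "\<phi> a" v] by (simp add: inv)
      have "C1_path (\<lambda>s. L (\<phi> (c s), \<omega> s) + b) (\<lambda>s. L (\<phi>' (c s) (c' s), \<Delta>) + 0)"
        using C1_path_line[of b 0] L
        by (intro C1_path_add C1_path_linear[OF C1_path_Pair[OF C1_path_compose[OF c(1) \<phi>] \<omega>]])
           (simp_all add: linear_conv_bounded_linear)
      then have "C1_path (\<lambda>s. h (p s)) (\<lambda>s. L (\<phi>' (c s) (c' s), \<Delta>))"
        by (simp add: p_def hL)
      \<comment> \<open>The chain rule through \<open>h\<close> and the affine representation give
        two derivatives of one path, which agree on a nondegenerate interval.\<close>
      then have "H (p s) (p' s) = L (\<phi>' (c s) (c' s), \<Delta>)"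
        by (rule C1_path_unique[OF hp _ that])
      also have "\<dots> = L (\<phi> y - \<phi> x, \<Delta>)"
        by (rule linear_eq_if_range_coords_eq[OF L L_axis
            geodesic_straight_coordinates[OF \<open>inj e\<close> \<open>bij \<phi>\<close> \<phi> \<psi> P_cont P_pd P_split geo c(1) that]])
      also have "\<dots> = h (y, u, w2) - h (x, u, w)"
        using linear_diff[OF L, of "(\<phi> y, w2)" "(\<phi> x, w)"] by (simp add: hL \<Delta>_def)
      finally show ?thesis .
    qed
    \<comment> \<open>Both supply terms are constant along the path, so integration over the unit
      interval reproduces them.\<close>
    define r where "r = wnorm2 Q \<Delta> + wnorm2 R (h (y, u, w2) - h (x, u, w))"
    have int_c: "(\<lambda>s. wnorm2 (P (c s)) (c' s)) integrable_on {0..1}"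
      by (intro integrable_continuous_real continuous_on_energy_density[OF c(1) P_cont])
    have const_r: "((\<lambda>_. r) has_integral r) {0..1::real}"
      using has_integral_const_real[of r 0 1] by simp
    have "((\<lambda>s. \<eta> * wnorm2 (P (c s)) (c' s) + r) has_integral \<eta> * energy P c + r) {0..1}"
      unfolding energy_C1_path[OF c(1)]
      by (intro has_integral_add has_integral_mult_right integrable_integral int_c const_r)
    then have rhs: "(\<lambda>s. \<eta> * wnorm2 (P (c s)) (c' s) + r) integrable_on {0..1}"
        "integral {0..1} (\<lambda>s. \<eta> * wnorm2 (P (c s)) (c' s) + r) = \<eta> * energy P c + r"
      by (auto simp: has_integral_integrable_integral)
    \<comment> \<open>The image of the path \<open>p\<close> under \<open>f\<close> joins the two
      successor states and is a continuously differentiable competitor.\<close>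
    have "min_energy P (f (x, u, w)) (f (y, u, w2))
        \<le> integral {0..1} (\<lambda>s. wnorm2 (P (f (p s))) (F (p s) (p' s)))"
      using min_energy_le_C1_path[OF P_cont P_psd fp] by (simp add: p_def c \<omega>_def \<Delta>_def)
    also have "\<dots> \<le> integral {0..1} (\<lambda>s. \<eta> * wnorm2 (P (c s)) (c' s) + r)"
    proof (rule integral_le[OF _ rhs(1)])
      show "(\<lambda>s. wnorm2 (P (f (p s))) (F (p s) (p' s))) integrable_on {0..1}"
        by (intro integrable_continuous_real continuous_on_energy_density[OF fp P_cont])
      show "wnorm2 (P (f (p s))) (F (p s) (p' s)) \<le> \<eta> * wnorm2 (P (c s)) (c' s) + r"
        if s: "s \<in> {0..1}" for s
      proof -
        have cs: "c s \<in> X" using c(4) s by blast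
        note partial = partial_jacobians_mult[OF F(1)[of "(c s, u, \<omega> s)"], of "c' s" \<Delta>]
          partial_jacobians_mult[OF H(1)[of "(c s, u, \<omega> s)"], of "c' s" \<Delta>]
        have "wnorm2 (P (f (p s))) (F (p s) (p' s))
            \<le> \<eta> * wnorm2 (P (c s)) (c' s) + wnorm2 Q \<Delta> + wnorm2 R (H (p s) (p' s))"
          using dissipation_from_LMI[OF LMI[OF cs \<open>u \<in> U\<close> \<omega>_mem[OF s], unfolded Let_def],
              of "c' s" \<Delta>]
          unfolding partial p_def p'_def .
        then show ?thesis by (simp add: rate[OF s] r_def)
      qed
    qed
    also have "\<dots> = \<eta> * energy P c + r" by (rule rhs(2))
    also have "\<dots> \<le> \<eta> * min_energy P x y + r"
      using c(5) \<open>0 \<le> \<eta>\<close> by (simp add: mult_left_mono)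
    finally show ?thesis
      by (simp add: r_def \<Delta>_def wnorm2_minus_commute[of Q w w2]
          wnorm2_minus_commute[of R "h (x, u, w)" "h (y, u, w2)"])
  qed
  have "quad_bounded_dIOSS_Lyapunov f h X U W Y (min_energy P)"
    unfolding quad_bounded_dIOSS_Lyapunov_def
  proof (intro conjI allI)
    show "0 \<le> min_energy P x y" for x y by (intro le_min_energy energy_nonneg P_psd)
  \<comment> \<open>The upper matrix \<open>K *\<^sub>R mat 1\<close> comes from the segment
    estimate; the elements of \<open>U\<close> and \<open>W\<close> needed in \<open>lower\<close>
    come from the membership premises.\<close>
  qed (rule exI[of _ \<eta>], rule exI[of _ P1], rule exI[of _ "K *\<^sub>R mat 1"], rule exI[of _ Q],
      rule exI[of _ R],
      use \<open>0 \<le> \<eta>\<close> \<open>\<eta> < 1\<close> \<open>pos_def P1\<close> pos_def_scaled_identity[OF K(1)]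
        \<open>pos_semidef Q\<close> \<open>pos_semidef R\<close> in \<open>auto intro: lower upper decrease\<close>)
  then show ?thesis by blast
qed

end
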